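(* Let $t\geq1$ be an integer. The following divisibilities hold for every integer $n\geq 0$: (i) If $t\equiv 0 \pmod 3$ or $t\equiv 1\pmod 3$, then $3\mid M(t,3n+2)$. (ii) If $t\equiv 0\pmod 5$, then $5\mid M(t,5n+2)$ and $5\mid M(t,5n+4)$. (iii) If $t\equiv 2\pmod 5$, then $5\mid M(t,5n+1)$ and $5\mid M(t,5n+3)$. (iv) If $t\equiv 2\pmod 7$, then $7\mid M(t,7n+1)$. (v) If $t\equiv 3\pmod 7$, then $7\mid M(t,7n+1)$, $7\mid M(t,7n+2)$, and $7\mid M(t,7n+6)$.
   Context: For $t\geq 1$, the integers $M(t,n)$ are defined by the formal power series $$\sum_{n\geq0}M(t,n)\,q^n=\sum_{k\geq1}\frac{(-1)^{k-1}(1+q^k)\,q^{\binom{k}{2}+tk}}{(1-q^k)^{2t}},$$ which is equal to $\sum_{1\leq k_1\leq k_2\leq\cdots\leq k_t}\frac{q^{k_1+k_2+\cdots+k_t}}{(1-q^{k_1})^2(1-q^{k_2})^2\cdots(1-q^{k_t})^2}$. *)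

theory Defs
  imports "HOL-Analysis.Analysis" "HOL-Number_Theory.Cong"
begin

text \<open>The type \<^typ>\<open>int\<close> carries no \<open>inverse\<close> operation, so there is no division on
  \<^typ>\<open>int fps\<close>. The denominator has constant coefficient 1 and its reciprocal in
  \<open>\<int>[[q]]\<close> is \<open>fps_right_inverse _ 1\<close>; see \<open>M_denom_inverse\<close> below.\<close>

definition M_term :: "nat \<Rightarrow> nat \<Rightarrow> int fps" where
  "M_term t k =
     (-1) ^ (k - 1) * (1 + fps_X ^ k) * fps_X ^ ((k choose 2) + t * k)
       * fps_right_inverse ((1 - fps_X ^ k) ^ (2 * t)) 1"

text \<open>The infinite sum is taken in the \<open>q\<close>-adic topology on \<^typ>\<open>int fps\<close>; it converges
  for \<open>t \<ge> 1\<close> by \<open>M_term_summable\<close> below.\<close>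

definition M :: "nat \<Rightarrow> nat \<Rightarrow> int" where
  "M t n = fps_nth (\<Sum>\<^sub>\<infinity>k\<in>{1..}. M_term t k) n"

lemma M_denom_inverse:
  assumes "k \<ge> 1"
  shows "(1 - fps_X ^ k :: int fps) ^ (2 * t) * fps_right_inverse ((1 - fps_X ^ k) ^ (2 * t)) 1 = 1"
  by (rule fps_right_inverse) (use assms in \<open>simp add: fps_power_zeroth power_0_left\<close>)

lemma M_term_nth_eq_0:
  assumes "t \<ge> 1" "k > n"
  shows "fps_nth (M_term t k) n = 0"
proof -
  have le: "k \<le> (k choose 2) + t * k"
    using assms(1) by (simp add: trans_le_add2)
  have "M_term t k = fps_X ^ ((k choose 2) + t * k) *
      ((-1) ^ (k - 1) * (1 + fps_X ^ k) * fps_right_inverse ((1 - fps_X ^ k) ^ (2 * t)) 1)"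
    unfolding M_term_def by (simp only: mult.assoc mult.left_commute)
  then show ?thesis
    using le assms(2) by (simp only: fps_X_power_mult_nth) simp
qed

lemma M_term_has_sum:
  assumes "t \<ge> 1"
  shows "(M_term t has_sum Abs_fps (\<lambda>n. \<Sum>k=1..n. fps_nth (M_term t k) n)) {1..}"
  unfolding has_sum_def
proof (rule tendsto_fpsI)
  fix n
  have "sum (\<lambda>k. fps_nth (M_term t k) n) F = (\<Sum>k=1..n. fps_nth (M_term t k) n)"
    if "finite F" "{1..n} \<subseteq> F" "F \<subseteq> {1..}" for F
  proof (rule sum.mono_neutral_right)
    show "\<forall>k\<in>F - {1..n}. fps_nth (M_term t k) n = 0"
    proof
      fix k assume "k \<in> F - {1..n}"
      with that(3) have "k > n" by auto
      then show "fps_nth (M_term t k) n = 0" by (rule M_term_nth_eq_0[OF assms])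
    qed
  qed (fact that(1), fact that(2))
  then show "\<forall>\<^sub>F F in finite_subsets_at_top {1..}.
      fps_nth (sum (M_term t) F) n = fps_nth (Abs_fps (\<lambda>n. \<Sum>k=1..n. fps_nth (M_term t k) n)) n"
    unfolding eventually_finite_subsets_at_top
    by (intro exI[of _ "{1..n}"] conjI allI impI)
       (simp_all only: fps_sum_nth fps_nth_Abs_fps, auto)
qed

lemma M_term_summable:
  assumes "t \<ge> 1"
  shows "M_term t summable_on {1..}"
  using M_term_has_sum[OF assms] by (auto simp: summable_on_def)

lemma M_eq_sum:
  assumes "t \<ge> 1"
  shows "M t n = (\<Sum>k=1..n. fps_nth (M_term t k) n)"
  using infsumI[OF M_term_has_sum[OF assms]] by (simp add: M_def)

end

theory Submission
  imports Defs "HOL-Computational_Algebra.Formal_Laurent_Series"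
begin

text \<open>
  Every single term of the sum over \<open>k\<close> already has the claimed divisibility, for a reason
  that concerns quadratic residues. Put \<open>G\<^sub>t(x) = x\<^sup>t (1 + x) / (1 - x)\<^bsup>2t\<^esup>\<close>; this series
  is \<open>M_kernel t\<close> below. The \<open>k\<close>-th term is \<open>\<plusminus>q\<^bsup>k(k-1)/2\<^esup> G\<^sub>t(q\<^sup>k)\<close>, so the
  coefficient of \<open>x\<^sup>m\<close> in \<open>G\<^sub>t\<close> contributes to \<open>M t n\<close> exactly when
  \<open>n = k(k-1)/2 + km\<close>. Completing the square turns this into
  \<open>(2k + 2m - 1)\<^sup>2 = b\<^sup>2 + 8n\<close> with \<open>b = 2m - 1\<close>. Modulo a prime \<open>p\<close>, only those \<open>m\<close> matter
  for which \<open>b\<^sup>2 + 8n\<close> is a square.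

  That condition depends on \<open>m\<close> modulo \<open>p\<close> only. Since \<open>(1 - x)\<^sup>p \<equiv> 1 - x\<^sup>p\<close>, the series
  \<open>G\<^bsub>t+p\<^esub>\<close> is congruent to \<open>G\<^sub>t\<close> times a power series in \<open>x\<^sup>p\<close>. Multiplication by such
  a series does not mix exponents from different classes modulo \<open>p\<close>, so the vanishing of
  \<open>G\<^sub>t\<close> modulo \<open>p\<close> on a union of classes carries over to \<open>G\<^bsub>t+p\<^esub>\<close>
  (\<open>dvd_M_kernel_add_prime\<close>), and the index \<open>t\<close> may be replaced by its remainder modulo \<open>p\<close>
  (\<open>prime_dvd_M_if_residue\<close>).

  What remains are the remainders \<open>0, 1, 2, 3\<close>. The coefficient of \<open>x\<^sup>m\<close> in \<open>G\<^sub>0\<close> is nonzero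
  only for \<open>b\<^sup>2 = 1\<close>; up to factors prime to \<open>p\<close>, it is \<open>b\<close> in \<open>G\<^sub>1\<close> for \<open>m \<ge> 1\<close>,
  \<open>b (b\<^sup>2 - 1)\<close> in \<open>G\<^sub>2\<close> and \<open>b (b\<^sup>2 - 1)(b\<^sup>2 - 9)\<close> in \<open>G\<^sub>3\<close>. For each of the listed residues
  of \<open>n\<close>, whenever \<open>b\<^sup>2 + 8n\<close> is a square modulo \<open>p\<close>, the coefficient is divisible by \<open>p\<close>.
  For instance, with \<open>p = 7\<close> and \<open>t \<equiv> 3\<close> the polynomial vanishes for
  \<open>b\<^sup>2 \<equiv> 0, 1, 2\<close>, and for the remaining square \<open>b\<^sup>2 \<equiv> 4\<close> the numbers \<open>4 + n\<close> with
  \<open>n \<equiv> 1, 2, 6\<close> are \<open>5, 6, 3\<close>, the nonsquares modulo \<open>7\<close>.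
\<close>

section \<open>The rational function behind the terms\<close>

definition geometric :: "int fps" where
  "geometric = Abs_fps (\<lambda>_. 1)"

text \<open>
  The expansion of \<open>x\<^sup>t (1 + x) / (1 - x)\<^bsup>2t\<^esup>\<close>. Writing the denominator through the geometric
  series gives integer coefficients without any division.
\<close>
definition M_kernel :: "nat \<Rightarrow> int fps" where
  "M_kernel t = fps_X ^ t * (1 + fps_X) * geometric ^ (2 * t)"

lemma geometric_inverse: "(1 - fps_X) * geometric = 1"
proof (rule fps_ext)
  fix m
  show "fps_nth ((1 - fps_X) * geometric) m = fps_nth 1 m"
    by (cases m) (simp_all add: geometric_def left_diff_distrib)
qed

lemma M_kernel_shift: "(1 - fps_X) ^ (2 * s) * M_kernel (t + s) = fps_X ^ s * M_kernel t"
proof -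
  have exponent: "2 * (t + s) = 2 * s + 2 * t"
    by simp
  have "(1 - fps_X) ^ (2 * s) * M_kernel (t + s)
      = ((1 - fps_X) ^ (2 * s) * geometric ^ (2 * s)) * (fps_X ^ s * M_kernel t)"
    unfolding M_kernel_def exponent power_add by (simp only: ac_simps)
  also have "(1 - fps_X) ^ (2 * s) * geometric ^ (2 * s) = 1"
    by (simp add: geometric_inverse flip: power_mult_distrib)
  finally show ?thesis
    by simp
qed

text \<open>
  Substituting \<open>q\<^sup>k\<close> into \<open>(1 - x) (1 + x + x\<^sup>2 + \<dots>) = 1\<close> shows that a power of the
  composed geometric series is an inverse of \<open>(1 - q\<^sup>k)\<^bsup>2t\<^esup>\<close>. Inverses in a commutative ring
  are unique, so it is the reciprocal in the \<open>k\<close>-th term.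
\<close>
lemma M_term_eq_compose:
  assumes "k \<ge> 1"
  shows "M_term t k = (-1) ^ (k - 1) * (fps_X ^ (k choose 2) * (M_kernel t oo fps_X ^ k))"
proof -
  have k0: "fps_nth (fps_X ^ k :: int fps) 0 = 0"
    using assms by (simp add: fps_power_zeroth)
  have comp: "M_kernel t oo fps_X ^ k
      = fps_X ^ (t * k) * (1 + fps_X ^ k) * (geometric oo fps_X ^ k) ^ (2 * t)"
    by (simp add: M_kernel_def fps_compose_mult_distrib[OF k0] fps_compose_add_distrib
        fps_compose_power[OF k0, symmetric] fps_X_fps_compose_startby0[OF k0]
        power_mult[symmetric] mult.commute[of k t])
  have "(1 - fps_X ^ k) * (geometric oo fps_X ^ k) = ((1 - fps_X) * geometric) oo fps_X ^ k"
    by (simp add: fps_compose_mult_distrib[OF k0] fps_compose_sub_distrib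
        fps_X_fps_compose_startby0[OF k0])
  also have "\<dots> = 1"
    by (simp add: geometric_inverse)
  finally have inv: "(1 - fps_X ^ k) ^ (2 * t) * (geometric oo fps_X ^ k) ^ (2 * t) = 1"
    by (simp flip: power_mult_distrib)
  define I where "I = fps_right_inverse ((1 - fps_X ^ k :: int fps) ^ (2 * t)) 1"
  have "I = ((1 - fps_X ^ k) ^ (2 * t) * (geometric oo fps_X ^ k) ^ (2 * t)) * I"
    using inv by simp
  also have "\<dots> = (geometric oo fps_X ^ k) ^ (2 * t) * ((1 - fps_X ^ k) ^ (2 * t) * I)"
    by (simp only: ac_simps)
  also have "\<dots> = (geometric oo fps_X ^ k) ^ (2 * t)"
    using M_denom_inverse[OF assms, of t] by (simp add: I_def)
  finally show ?thesis
    unfolding M_term_def I_def[symmetric] comp power_add by (simp only: ac_simps)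
qed

section \<open>Which coefficients contribute\<close>

lemma int_choose_two: "2 * int (k choose 2) = int k * (int k - 1)"
proof -
  have "2 * (k choose 2) = k * (k - 1)"
    unfolding choose_two by (intro dvd_mult_div_cancel) (cases k, simp_all)
  then have "int (2 * (k choose 2)) = int (k * (k - 1))"
    by (rule arg_cong)
  then show ?thesis
    by (cases k) (simp_all add: algebra_simps)
qed

text \<open>
  The \<open>m\<close>-th coefficient enters the \<open>k\<close>-th term at \<open>n = k(k-1)/2 + km\<close>, and multiplying this
  equation by \<open>8\<close> gives \<open>4k\<^sup>2 + 4k(2m - 1) = 8n\<close>, a difference of two squares.
\<close>
lemma dvd_M_termwise:
  assumes "t \<ge> 1"
  assumes dvd: "\<And>m u. u\<^sup>2 = (2 * int m - 1)\<^sup>2 + 8 * int n \<Longrightarrow> p dvd fps_nth (M_kernel t) m"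
  shows "p dvd M t n"
  unfolding M_eq_sum[OF assms(1)]
proof (rule dvd_sum)
  fix k assume "k \<in> {1..n}"
  then have k: "k \<ge> 1" by simp
  have "p dvd fps_nth (fps_X ^ (k choose 2) * (M_kernel t oo fps_X ^ k)) n"
  proof (cases "(k choose 2) \<le> n \<and> k dvd n - (k choose 2)")
    case True
    then obtain m where m: "n = (k choose 2) + k * m"
      by (metis dvd_def le_add_diff_inverse)
    have "8 * int n = 4 * (int k * (int k - 1)) + 8 * (int k * int m)"
      unfolding m int_choose_two[symmetric] by simp
    then have "(2 * int k + 2 * int m - 1)\<^sup>2 = (2 * int m - 1)\<^sup>2 + 8 * int n"
      by (simp add: power2_eq_square algebra_simps)
    then have "p dvd fps_nth (M_kernel t) m"
      by (rule dvd)
    then show ?thesis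
      using k by (simp add: m fps_X_power_mult_nth fps_nth_compose_X_power)
  next
    case False
    then show ?thesis
      by (auto simp: fps_X_power_mult_nth fps_nth_compose_X_power)
  qed
  moreover have "M_term t k
      = fps_const ((-1) ^ (k - 1)) * (fps_X ^ (k choose 2) * (M_kernel t oo fps_X ^ k))"
    by (simp add: M_term_eq_compose[OF k] flip: fps_const_power fps_const_neg)
  ultimately show "p dvd fps_nth (M_term t k) n"
    by simp
qed

section \<open>Reducing the index modulo a prime\<close>

lemma one_minus_X_power_prime:
  assumes "prime p" "odd p"
  obtains E :: "int fps" where "(1 - fps_X) ^ p = 1 - fps_X ^ p + of_nat p * E"
proof -
  have "\<exists>E :: int fps. (1 - fps_X) ^ p = 1 - fps_X ^ p + of_nat p * E"
  proof -
    have p: "p > 0" using assms(1) by (rule prime_gt_0_nat)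
    have choose_eq: "of_nat (p choose i) = (of_nat p * of_nat ((p choose i) div p) :: int fps)"
      if "i \<in> {1..<p}" for i
    proof -
      have "p dvd p choose i"
        using that assms(1) by (intro dvd_choose_prime) auto
      then show ?thesis
        by (metis dvd_mult_div_cancel of_nat_mult)
    qed
    have "(1 - fps_X :: int fps) ^ p = (\<Sum>i\<le>p. of_nat (p choose i) * (- fps_X) ^ i)"
      using binomial_ring[of "- fps_X :: int fps" 1 p] by simp
    also have "{..p} = insert 0 (insert p {1..<p})"
      using p by auto
    also have "(\<Sum>i\<in>\<dots>. of_nat (p choose i) * (- fps_X :: int fps) ^ i)
        = 1 - fps_X ^ p + (\<Sum>i=1..<p. of_nat (p choose i) * (- fps_X) ^ i)"
      using p assms(2) by (simp add: power_minus_odd)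
    also have "(\<Sum>i=1..<p. of_nat (p choose i) * (- fps_X :: int fps) ^ i)
        = of_nat p * (\<Sum>i=1..<p. of_nat ((p choose i) div p) * (- fps_X) ^ i)"
      unfolding sum_distrib_left by (intro sum.cong refl) (simp only: choose_eq mult.assoc)
    finally show ?thesis by blast
  qed
  then show thesis using that by blast
qed

text \<open>
  The coefficients of \<open>f\<close> on a class modulo \<open>p\<close> are the partial sums, along that class, of those
  of \<open>(1 - x\<^sup>p) f\<close>. This replaces a multiplication by the series \<open>1 / (1 - x\<^sup>p)\<close>.
\<close>
lemma dvd_nth_cancel_one_minus_X_power:
  fixes f :: "int fps"
  assumes p: "p > 0"
  assumes periodic: "\<And>m. R (m + p) \<longleftrightarrow> R m"
  assumes "\<And>m. R m \<Longrightarrow> d dvd fps_nth ((1 - fps_X ^ p) * f) m"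
  assumes "R m"
  shows "d dvd fps_nth f m"
  using \<open>R m\<close>
proof (induction m rule: less_induct)
  case (less m)
  have eq: "fps_nth ((1 - fps_X ^ p) * f) m = fps_nth f m
      - (if m < p then 0 else fps_nth f (m - p))"
    by (simp add: left_diff_distrib fps_X_power_mult_nth)
  show ?case
  proof (cases "m < p")
    case True
    then show ?thesis using assms(3)[OF less.prems] eq by simp
  next
    case False
    then have "R (m - p)" using less.prems periodic[of "m - p"] by simp
    then have "d dvd fps_nth f (m - p)"
      using False p by (intro less.IH) auto
    then show ?thesis
      using assms(3)[OF less.prems] eq False by (simp add: dvd_diff_left_iff)
  qed
qed

text \<open>
  From \<open>(1 - x)\<^bsup>2p\<^esup> G\<^bsub>t+p\<^esub> = x\<^sup>p G\<^sub>t\<close> one gets \<open>(1 - x\<^sup>p)\<^sup>2 G\<^bsub>t+p\<^esub> \<equiv> x\<^sup>p G\<^sub>t\<close> modulo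
  \<open>p\<close>. The shift by \<open>p\<close> respects the \<open>p\<close>-periodic set \<open>R\<close>, and the two factors \<open>1 - x\<^sup>p\<close>
  can be cancelled one after the other.
\<close>
lemma dvd_M_kernel_add_prime:
  assumes p: "prime p" "odd p"
  assumes periodic: "\<And>m. R (m + p) \<longleftrightarrow> R m"
  assumes dvd: "\<And>m. R m \<Longrightarrow> int p dvd fps_nth (M_kernel t) m"
  assumes "R m"
  shows "int p dvd fps_nth (M_kernel (t + p)) m"
proof -
  have p0: "p > 0" using p(1) by (rule prime_gt_0_nat)
  obtain E :: "int fps" where E: "(1 - fps_X) ^ p = 1 - fps_X ^ p + of_nat p * E"
    using one_minus_X_power_prime[OF p] .
  define D where "D = (1 - fps_X ^ p :: int fps)"
  have "(D + of_nat p * E)\<^sup>2 * M_kernel (t + p) = fps_X ^ p * M_kernel t"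
    using M_kernel_shift[of p t]
    by (simp only: D_def E[symmetric] power_mult[symmetric] mult.commute[of 2 p])
  then have eq: "D * (D * M_kernel (t + p)) = fps_X ^ p * M_kernel t
      - of_nat p * ((2 * D * E + of_nat p * E\<^sup>2) * M_kernel (t + p))"
    by (simp add: power2_eq_square algebra_simps)
  have nth: "fps_nth (of_nat p * f) i = int p * fps_nth f i" for f :: "int fps" and i
    by (simp add: fps_of_nat[symmetric])
  have "int p dvd fps_nth (D * (D * M_kernel (t + p))) i" if "R i" for i
  proof -
    have "int p dvd fps_nth (M_kernel t) (i - p)" if "\<not> i < p"
      using dvd \<open>R i\<close> periodic[of "i - p"] that by simp
    then show ?thesis
      unfolding eq by (simp add: nth fps_X_power_mult_nth)
  qed
  then have "int p dvd fps_nth (D * M_kernel (t + p)) i" if "R i" for i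
    using dvd_nth_cancel_one_minus_X_power[OF p0, of R] periodic that unfolding D_def by blast
  then show ?thesis
    using dvd_nth_cancel_one_minus_X_power[OF p0, of R] periodic \<open>R m\<close> unfolding D_def by blast
qed

text \<open>
  The induction from \<open>a\<close> to \<open>t\<close> in steps of \<open>p\<close> needs a \<open>p\<close>-periodic set of exponents. The
  solutions \<open>m\<close> of the integer equation between squares do not form one in general, but those of
  its reduction modulo \<open>p\<close> do.
\<close>
lemma prime_dvd_M_if_residue:
  assumes p: "prime p" "odd p" and "t \<ge> 1" "[t = a] (mod p)" "a < p"
  assumes base: "\<And>m u. [u\<^sup>2 = (2 * int m - 1)\<^sup>2 + 8 * int n] (mod int p)
      \<Longrightarrow> int p dvd fps_nth (M_kernel a) m"
  shows "int p dvd M t n"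
proof -
  define R where "R m \<longleftrightarrow> (\<exists>u. [u\<^sup>2 = (2 * int m - 1)\<^sup>2 + 8 * int n] (mod int p))" for m
  have periodic: "R (m + p) \<longleftrightarrow> R m" for m
  proof -
    have "(2 * int (m + p) - 1)\<^sup>2 + 8 * int n
        = (2 * int m - 1)\<^sup>2 + 8 * int n + int p * (4 * (2 * int m - 1) + 4 * int p)"
      by (simp add: power2_eq_square algebra_simps)
    then show ?thesis
      unfolding R_def cong_def by (simp only: mod_mult_self2)
  qed
  have "t mod p = a"
    using assms(4,5) by (simp add: cong_def)
  then obtain s where t: "t = a + s * p"
    by (metis mod_mult_div_eq add.commute mult.commute mod_div_mult_eq)
  have "int p dvd fps_nth (M_kernel (a + s * p)) m" if "R m" for m
    using that
  proof (induction s arbitrary: m)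
    case 0
    then show ?case using base by (auto simp: R_def)
  next
    case (Suc s)
    then show ?case
      using dvd_M_kernel_add_prime[OF p, of R "a + s * p" m] periodic by (simp add: add_ac)
  qed
  then show ?thesis
    unfolding t[symmetric] by (intro dvd_M_termwise[OF \<open>t \<ge> 1\<close>]) (metis R_def cong_refl)
qed

section \<open>Closed forms for small index\<close>

lemma nth_M_kernel_zero: "fps_nth (M_kernel 0) m = (if m \<le> 1 then 1 else 0)"
  by (cases m) (auto simp: M_kernel_def fps_X_def)

text \<open>
  Comparing coefficients in \<open>(1 - x)\<^sup>2 G\<^bsub>t+1\<^esub> = x G\<^sub>t\<close> yields a second-order recurrence,
  which proves the closed forms below by induction. For \<open>m \<ge> 1\<close> these are
  instances of \<open>(2m - 1) / (2t - 1) \<cdot> (m + t - 2 choose 2t - 2)\<close>, an odd polynomial in \<open>2m - 1\<close>.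
\<close>
lemma nth_M_kernel_Suc:
  "fps_nth (M_kernel (Suc t)) 0 = 0"
  "fps_nth (M_kernel (Suc t)) (Suc 0) = fps_nth (M_kernel t) 0"
  "fps_nth (M_kernel (Suc t)) (Suc (Suc m))
    = 2 * fps_nth (M_kernel (Suc t)) (Suc m) - fps_nth (M_kernel (Suc t)) m
      + fps_nth (M_kernel t) (Suc m)"
proof -
  let ?K = "M_kernel (Suc t)"
  have "fps_X * M_kernel t = ?K - fps_X * ?K - fps_X * ?K + fps_X * (fps_X * ?K)"
    using M_kernel_shift[of 1 t] by (simp add: power2_eq_square algebra_simps)
  then have eq: "fps_nth (fps_X * M_kernel t) i
      = fps_nth (?K - fps_X * ?K - fps_X * ?K + fps_X * (fps_X * ?K)) i" for i
    by simp
  show z: "fps_nth ?K 0 = 0" using eq[of 0] by simp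
  show "fps_nth ?K (Suc 0) = fps_nth (M_kernel t) 0" using eq[of "Suc 0"] z by simp
  show "fps_nth ?K (Suc (Suc m))
    = 2 * fps_nth ?K (Suc m) - fps_nth ?K m + fps_nth (M_kernel t) (Suc m)"
    using eq[of "Suc (Suc m)"] by simp
qed

lemma nth_M_kernel_one: "fps_nth (M_kernel 1) m = (if m = 0 then 0 else 2 * int m - 1)"
proof (induction m rule: induct_nat_012)
  case (ge2 m)
  then show ?case by (simp add: nth_M_kernel_Suc nth_M_kernel_zero)
qed (simp_all add: nth_M_kernel_Suc nth_M_kernel_zero)

lemma nth_M_kernel_two:
  "24 * fps_nth (M_kernel 2) m = (2 * int m - 1) * ((2 * int m - 1)\<^sup>2 - 1)"
proof (induction m rule: induct_nat_012)
  case (ge2 m)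
  have "fps_nth (M_kernel 2) (Suc (Suc m))
      = 2 * fps_nth (M_kernel 2) (Suc m) - fps_nth (M_kernel 2) m + (2 * int (Suc m) - 1)"
    using nth_M_kernel_Suc(3)[of 1 m] nth_M_kernel_one[of "Suc m"] by (simp add: numeral_2_eq_2)
  with ge2 show ?case
    by (simp add: power2_eq_square algebra_simps)
qed (simp_all add: numeral_2_eq_2 nth_M_kernel_Suc nth_M_kernel_zero)

lemma nth_M_kernel_three:
  "1920 * fps_nth (M_kernel 3) m
    = (2 * int m - 1) * ((2 * int m - 1)\<^sup>2 - 1) * ((2 * int m - 1)\<^sup>2 - 9)"
proof (induction m rule: induct_nat_012)
  case (ge2 m)
  have "fps_nth (M_kernel 3) (Suc (Suc m))
      = 2 * fps_nth (M_kernel 3) (Suc m) - fps_nth (M_kernel 3) m + fps_nth (M_kernel 2) (Suc m)"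
    using nth_M_kernel_Suc(3)[of 2 m] by (simp add: numeral_3_eq_3 numeral_2_eq_2)
  with ge2 nth_M_kernel_two[of "Suc m"] show ?case
    by (simp add: power2_eq_square algebra_simps)
qed (simp_all add: numeral_3_eq_3 nth_M_kernel_Suc nth_M_kernel_zero)

section \<open>Squares modulo 3, 5 and 7\<close>

lemma square_mod_3: "(u::int)\<^sup>2 mod 3 \<in> {0, 1}"
proof -
  have "u mod 3 \<in> {0, 1, 2}" by auto
  then have "(u mod 3)\<^sup>2 mod 3 \<in> {0, 1}" by auto
  then show ?thesis by (simp add: power_mod)
qed

lemma square_mod_5: "(u::int)\<^sup>2 mod 5 \<in> {0, 1, 4}"
proof -
  have "u mod 5 \<in> {0, 1, 2, 3, 4}" by auto
  then have "(u mod 5)\<^sup>2 mod 5 \<in> {0, 1, 4}" by auto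
  then show ?thesis by (simp add: power_mod)
qed

lemma square_mod_7: "(u::int)\<^sup>2 mod 7 \<in> {0, 1, 2, 4}"
proof -
  have "u mod 7 \<in> {0, 1, 2, 3, 4, 5, 6}" by auto
  then have "(u mod 7)\<^sup>2 mod 7 \<in> {0, 1, 2, 4}" by auto
  then show ?thesis by (simp add: power_mod)
qed

lemma cong_square_residue:
  fixes u b :: int
  assumes "[u\<^sup>2 = b\<^sup>2 + 8 * int n] (mod int p)"
  shows "u\<^sup>2 mod int p = (b\<^sup>2 mod int p + 8 * int (n mod p)) mod int p"
proof -
  have "(b\<^sup>2 mod int p + 8 * int (n mod p)) mod int p = (b\<^sup>2 + 8 * int n) mod int p"
    unfolding zmod_int by (rule mod_add_cong) (simp_all add: mod_mult_right_eq)
  then show ?thesis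
    using assms by (simp add: cong_def)
qed

section \<open>The congruences\<close>

text \<open>
  Each proof below excludes the classes of \<open>b\<^sup>2\<close> on which the coefficient is not divisible by
  \<open>p\<close>, where \<open>b = 2m - 1\<close>: there \<open>b\<^sup>2 + 8n\<close> is not a square. The nonzero
  coefficients of \<open>G\<^sub>0\<close> have \<open>m \<le> 1\<close>, thus \<open>b\<^sup>2 = 1\<close>, and \<open>1 + 8 \<cdot> 2 \<equiv> 2\<close> is not a square modulo \<open>3\<close>.
\<close>
lemma three_dvd_M_if_cong_0:
  assumes "t \<ge> 1" "[t = 0] (mod 3)" "n mod 3 = 2"
  shows "3 dvd M t n"
proof -
  have "int 3 dvd M t n"
  proof (rule prime_dvd_M_if_residue[where a = 0])
    fix m :: nat and u :: int
    assume u: "[u\<^sup>2 = (2 * int m - 1)\<^sup>2 + 8 * int n] (mod int 3)"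
    show "int 3 dvd fps_nth (M_kernel 0) m"
    proof (cases "m \<le> 1")
      case True
      then have "(2 * int m - 1)\<^sup>2 = 1" by (cases m) auto
      then show ?thesis
        using cong_square_residue[OF u] assms(3) square_mod_3[of u] by auto
    qed (simp add: nth_M_kernel_zero)
  qed (use assms in auto)
  then show ?thesis by simp
qed

text \<open>
  For \<open>b\<^sup>2 \<equiv> 1\<close> the number \<open>b\<^sup>2 + 8n\<close> would again be \<open>2\<close> modulo \<open>3\<close>, hence \<open>3\<close> divides \<open>b\<close>.
\<close>
lemma three_dvd_M_if_cong_1:
  assumes "t \<ge> 1" "[t = 1] (mod 3)" "n mod 3 = 2"
  shows "3 dvd M t n"
proof -
  have "int 3 dvd M t n"
  proof (rule prime_dvd_M_if_residue[where a = 1])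
    fix m :: nat and u :: int
    define b where "b = 2 * int m - 1"
    assume u: "[u\<^sup>2 = (2 * int m - 1)\<^sup>2 + 8 * int n] (mod int 3)"
    have "3 dvd b\<^sup>2"
      using cong_square_residue[OF u[folded b_def]] assms(3) square_mod_3[of u] square_mod_3[of b]
      by (auto simp: mod_eq_0_iff_dvd mod_eq_dvd_iff[symmetric])
    then have "3 dvd b" by (rule prime_dvd_power[rotated]) simp
    then show "int 3 dvd fps_nth (M_kernel 1) m"
      unfolding nth_M_kernel_one b_def by simp
  qed (use assms in auto)
  then show ?thesis by simp
qed

text \<open>
  With \<open>b\<^sup>2 = 1\<close>, the number \<open>1 + 8n\<close> is \<open>2\<close> or \<open>3\<close> modulo \<open>5\<close>. Equivalently, triangular
  numbers are never \<open>2\<close> or \<open>4\<close> modulo \<open>5\<close>.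
\<close>
lemma five_dvd_M_if_cong_0:
  assumes "t \<ge> 1" "[t = 0] (mod 5)" "n mod 5 \<in> {2, 4}"
  shows "5 dvd M t n"
proof -
  have "int 5 dvd M t n"
  proof (rule prime_dvd_M_if_residue[where a = 0])
    fix m :: nat and u :: int
    assume u: "[u\<^sup>2 = (2 * int m - 1)\<^sup>2 + 8 * int n] (mod int 5)"
    show "int 5 dvd fps_nth (M_kernel 0) m"
    proof (cases "m \<le> 1")
      case True
      then have "(2 * int m - 1)\<^sup>2 = 1" by (cases m) auto
      then show ?thesis
        using cong_square_residue[OF u] assms(3) square_mod_5[of u] by auto
    qed (simp add: nth_M_kernel_zero)
  qed (use assms in auto)
  then show ?thesis by simp
qed

text \<open>
  Only \<open>b\<^sup>2 \<equiv> 4\<close> is to be excluded, where \<open>b\<^sup>2 + 8n\<close> is \<open>2\<close> or \<open>3\<close> modulo \<open>5\<close>.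
\<close>
lemma five_dvd_M_if_cong_2:
  assumes "t \<ge> 1" "[t = 2] (mod 5)" "n mod 5 \<in> {1, 3}"
  shows "5 dvd M t n"
proof -
  have "int 5 dvd M t n"
  proof (rule prime_dvd_M_if_residue[where a = 2])
    fix m :: nat and u :: int
    define b where "b = 2 * int m - 1"
    assume u: "[u\<^sup>2 = (2 * int m - 1)\<^sup>2 + 8 * int n] (mod int 5)"
    have "5 dvd b\<^sup>2 \<or> 5 dvd b\<^sup>2 - 1"
      using cong_square_residue[OF u[folded b_def]] assms(3) square_mod_5[of u] square_mod_5[of b]
      by (auto simp: mod_eq_0_iff_dvd mod_eq_dvd_iff[symmetric])
    then have "5 dvd b * (b\<^sup>2 - 1)"
      using prime_dvd_power[of "5::int" b 2] by auto
    then show "int 5 dvd fps_nth (M_kernel 2) m"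
      using prime_dvd_mult_iff[of "5::int" 24] by (simp add: b_def flip: nth_M_kernel_two)
  qed (use assms in auto)
  then show ?thesis by simp
qed

text \<open>
  The squares \<open>2\<close> and \<open>4\<close> are to be excluded as values of \<open>b\<^sup>2\<close>; as \<open>8n \<equiv> 1\<close>, they would give
  the nonsquares \<open>3\<close> and \<open>5\<close>.
\<close>
lemma seven_dvd_M_if_cong_2:
  assumes "t \<ge> 1" "[t = 2] (mod 7)" "n mod 7 = 1"
  shows "7 dvd M t n"
proof -
  have "int 7 dvd M t n"
  proof (rule prime_dvd_M_if_residue[where a = 2])
    fix m :: nat and u :: int
    define b where "b = 2 * int m - 1"
    assume u: "[u\<^sup>2 = (2 * int m - 1)\<^sup>2 + 8 * int n] (mod int 7)"
    have "7 dvd b\<^sup>2 \<or> 7 dvd b\<^sup>2 - 1"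
      using cong_square_residue[OF u[folded b_def]] assms(3) square_mod_7[of u] square_mod_7[of b]
      by (auto simp: mod_eq_0_iff_dvd mod_eq_dvd_iff[symmetric])
    then have "7 dvd b * (b\<^sup>2 - 1)"
      using prime_dvd_power[of "7::int" b 2] by auto
    then show "int 7 dvd fps_nth (M_kernel 2) m"
      using prime_dvd_mult_iff[of "7::int" 24] by (simp add: b_def flip: nth_M_kernel_two)
  qed (use assms in auto)
  then show ?thesis by simp
qed

text \<open>
  The factor \<open>b\<^sup>2 - 9\<close> takes care of \<open>b\<^sup>2 \<equiv> 2\<close>, so only \<open>b\<^sup>2 \<equiv> 4\<close> is to be excluded; there
  \<open>b\<^sup>2 + 8n\<close> is one of the nonsquares \<open>5, 6, 3\<close>.
\<close>
lemma seven_dvd_M_if_cong_3: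
  assumes "t \<ge> 1" "[t = 3] (mod 7)" "n mod 7 \<in> {1, 2, 6}"
  shows "7 dvd M t n"
proof -
  have "int 7 dvd M t n"
  proof (rule prime_dvd_M_if_residue[where a = 3])
    fix m :: nat and u :: int
    define b where "b = 2 * int m - 1"
    assume u: "[u\<^sup>2 = (2 * int m - 1)\<^sup>2 + 8 * int n] (mod int 7)"
    have "7 dvd b\<^sup>2 \<or> 7 dvd b\<^sup>2 - 1 \<or> 7 dvd b\<^sup>2 - 9"
      using cong_square_residue[OF u[folded b_def]] assms(3) square_mod_7[of u] square_mod_7[of b]
      by (auto simp: mod_eq_0_iff_dvd mod_eq_dvd_iff[symmetric])
    then have "7 dvd b * (b\<^sup>2 - 1) * (b\<^sup>2 - 9)"
      using prime_dvd_power[of "7::int" b 2] by auto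
    then show "int 7 dvd fps_nth (M_kernel 3) m"
      using prime_dvd_mult_iff[of "7::int" 1920] by (simp add: b_def flip: nth_M_kernel_three)
  qed (use assms in auto)
  then show ?thesis by simp
qed

theorem theorem8p1:
  fixes t n :: nat
  assumes "t \<ge> 1"
  shows "([t = 0] (mod 3) \<or> [t = 1] (mod 3) \<longrightarrow> 3 dvd M t (3 * n + 2))
    \<and> ([t = 0] (mod 5) \<longrightarrow> 5 dvd M t (5 * n + 2) \<and> 5 dvd M t (5 * n + 4))
    \<and> ([t = 2] (mod 5) \<longrightarrow> 5 dvd M t (5 * n + 1) \<and> 5 dvd M t (5 * n + 3))
    \<and> ([t = 2] (mod 7) \<longrightarrow> 7 dvd M t (7 * n + 1))
    \<and> ([t = 3] (mod 7) \<longrightarrow>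
          7 dvd M t (7 * n + 1) \<and> 7 dvd M t (7 * n + 2) \<and> 7 dvd M t (7 * n + 6))"
proof (intro conjI impI)
  show "3 dvd M t (3 * n + 2)" if "[t = 0] (mod 3) \<or> [t = 1] (mod 3)"
    using that three_dvd_M_if_cong_0[OF assms] three_dvd_M_if_cong_1[OF assms]
    by (auto simp del: add_2_eq_Suc add_2_eq_Suc')
qed (simp_all add: five_dvd_M_if_cong_0[OF assms] five_dvd_M_if_cong_2[OF assms]
    seven_dvd_M_if_cong_2[OF assms] seven_dvd_M_if_cong_3[OF assms]
    del: add_2_eq_Suc add_2_eq_Suc')

end
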